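(* Let $\mathbb{F}\in\{\mathbb{R},\mathbb{C}\}$, let $n$ be a positive integer and let $A\in\mathbb{F}^{n\times n}$. Define $$\mu(A)=\limsup_{k\to\infty}\Big(\max\big\{\|AD_1AD_2\cdots AD_k\mathbf{x}\|_2 : D_1,\dots,D_k\in\mathcal{D}_n(\mathbb{F}),\ \mathbf{x}\in\mathbb{F}^n,\ \|\mathbf{x}\|_2=1\big\}\Big)^{1/k}.$$ Then $$\mu(A)=\inf\{\|A\|_{\mathbb{F}} : \|\cdot\|_{\mathbb{F}}\in\mathcal{N}(n,\mathbb{F})\},$$ where $\mathcal{N}(n,\mathbb{F})$ is the set of all absolute norms on $\mathbb{F}^n$ and $\|A\|_{\mathbb{F}}$ is the operator norm of $A$ induced by $\|\cdot\|_{\mathbb{F}}$.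
   Context: $\|\cdot\|_2$ is the Euclidean norm on $\mathbb{F}^n$. $\mathcal{D}_n(\mathbb{F})$ is the group of diagonal matrices in $\mathbb{F}^{n\times n}$ all of whose diagonal entries have absolute value $1$. For $\mathbf{x}=(x_1,\dots,x_n)^\top\in\mathbb{F}^n$ put $|\mathbf{x}|=(|x_1|,\dots,|x_n|)^\top$. A norm $\|\cdot\|_{\mathbb{F}}$ on the $\mathbb{F}$-vector space $\mathbb{F}^n$ is called absolute if $\|\mathbf{x}\|_{\mathbb{F}}=\||\mathbf{x}|\|_{\mathbb{F}}$ for all $\mathbf{x}\in\mathbb{F}^n$. The induced operator norm is $\|A\|_{\mathbb{F}}=\max\{\|A\mathbf{x}\|_{\mathbb{F}} : \mathbf{x}\in\mathbb{F}^n,\ \|\mathbf{x}\|_{\mathbb{F}}\le 1\}$. In the product $AD_1AD_2\cdots AD_k$ there are $k$ factors $A$, each followed by one of $D_1,\dots,D_k$. *)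

theory Defs
  imports "HOL-Analysis.Analysis"
begin

text \<open>
  The definitions are generic in the scalar type and are meant to be used at the types
  \<open>real\<close> and \<open>complex\<close>. At both types the library norm on \<open>'a ^ 'n\<close> is the Euclidean norm.
\<close>

definition unimodular_diag :: "('a::real_normed_field ^ 'n ^ 'n) set" where
  "unimodular_diag = {D. (\<forall>i j. i \<noteq> j \<longrightarrow> D $ i $ j = 0) \<and> (\<forall>i. norm (D $ i $ i) = 1)}"

fun interleaved_prod :: "'a::real_normed_field ^ 'n ^ 'n \<Rightarrow> ('a ^ 'n ^ 'n) list \<Rightarrow> 'a ^ 'n ^ 'n" where
  "interleaved_prod A [] = mat 1"
| "interleaved_prod A (D # Ds) = A ** D ** interleaved_prod A Ds"

text \<open>
  The maxima in the next definition and in the operator norm below exist by compactness and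
  are therefore written as suprema. The limit superior is taken in the extended reals, so
  that no boundedness of the sequence is presupposed; the irrelevant term at \<open>k = 0\<close> is
  \<open>root 0 _ = 0\<close>.
\<close>

definition mu :: "'a::real_normed_field ^ 'n ^ 'n \<Rightarrow> ereal" where
  "mu A = limsup (\<lambda>k. ereal (root k (Sup {norm (interleaved_prod A Ds *v x) | Ds x.
     length Ds = k \<and> set Ds \<subseteq> unimodular_diag \<and> norm x = 1})))"

definition is_norm :: "('a::real_normed_field ^ 'n \<Rightarrow> real) \<Rightarrow> bool" where
  "is_norm N \<longleftrightarrow>
     (\<forall>x. 0 \<le> N x) \<and>
     (\<forall>x. N x = 0 \<longleftrightarrow> x = 0) \<and>
     (\<forall>c x. N (c *s x) = norm c * N x) \<and>
     (\<forall>x y. N (x + y) \<le> N x + N y)"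

definition vec_abs :: "'a::real_normed_field ^ 'n \<Rightarrow> 'a ^ 'n" where
  "vec_abs x = (\<chi> i. of_real (norm (x $ i)))"

definition absolute_norms :: "('a::real_normed_field ^ 'n \<Rightarrow> real) set" where
  "absolute_norms = {N. is_norm N \<and> (\<forall>x. N x = N (vec_abs x))}"

definition induced_norm ::
    "('a::real_normed_field ^ 'n \<Rightarrow> real) \<Rightarrow> 'a ^ 'n ^ 'n \<Rightarrow> real" where
  "induced_norm N A = Sup {N (A *v x) | x. N x \<le> 1}"

end

theory Submission
  imports Defs
begin

text \<open>
  An absolute norm is invariant under \<open>unimodular_diag\<close>, so a product with \<open>k\<close> factors \<open>A\<close>
  has operator norm at most the \<open>k\<close>-th power of that of \<open>A\<close>; comparing with the Euclidean norm
  costs a constant factor, which disappears under \<open>k\<close>-th roots. Conversely, for \<open>r > mu A\<close>,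
  the supremum of all \<open>\<parallel>A D\<^sub>1 \<cdots> A D\<^sub>k D x\<parallel>\<^sub>2 / r ^ k\<close> is finite and is an absolute norm
  of \<open>x\<close> for which \<open>A\<close> has operator norm at most \<open>r\<close>.
\<close>

section \<open>Euclidean bounds for seminorms and matrices\<close>

lemma norm_vector_scalar_mult:
  fixes x :: "'a::real_normed_field ^ 'n"
  shows "norm (c *s x) = norm c * norm x"
  by (simp add: norm_vec_def norm_mult L2_set_right_distrib)

text \<open>Expand \<open>x\<close> in the standard basis and use subadditivity. Working with
  seminorms covers \<open>\<lambda>x. norm (A *v x)\<close> as well as absolute norms.\<close>

lemma seminorm_le_sum_axis:
  fixes f :: "'a::real_normed_field ^ 'n \<Rightarrow> real"
  assumes nonneg: "\<And>x. 0 \<le> f x"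
    and scale: "\<And>c x. f (c *s x) = norm c * f x"
    and triangle: "\<And>x y. f (x + y) \<le> f x + f y"
  shows "f x \<le> (\<Sum>i\<in>UNIV. f (axis i 1)) * norm x"
proof -
  have f0: "f 0 = 0"
    using scale[of 0 0] by simp
  have fsum: "f (sum g S) \<le> (\<Sum>i\<in>S. f (g i))" if "finite S" for g and S :: "'n set"
    using that
    by (induction S rule: finite_induct) (auto simp: f0 intro: order_trans[OF triangle])
  have "f x = f (\<Sum>i\<in>UNIV. x $ i *s axis i 1)"
    by (simp add: basis_expansion)
  also have "\<dots> \<le> (\<Sum>i\<in>UNIV. f (x $ i *s axis i 1))"
    by (rule fsum) simp
  also have "\<dots> = (\<Sum>i\<in>UNIV. norm (x $ i) * f (axis i 1))"
    by (simp add: scale)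
  also have "\<dots> \<le> (\<Sum>i\<in>UNIV. norm x * f (axis i 1))"
    by (intro sum_mono mult_right_mono Finite_Cartesian_Product.norm_nth_le nonneg)
  finally show ?thesis
    by (simp add: sum_distrib_left mult.commute)
qed

lemma norm_axis_one: "norm (axis i (1::'a::real_normed_field)) = 1"
proof -
  have "(norm (axis i (1::'a) $ j))\<^sup>2 = (if j = i then 1 else 0)" for j
    by (simp add: axis_def)
  then show ?thesis
    by (simp add: norm_vec_def L2_set_def)
qed

text \<open>The left side is a seminorm in \<open>x\<close>. The constant is crude; its purpose is
  to show that the suprema below are finite.\<close>

lemma norm_matrix_vector_le:
  fixes A :: "'a::real_normed_field ^ 'n ^ 'm"
  shows "norm (A *v x) \<le> (\<Sum>i\<in>UNIV. norm (A *v axis i 1)) * norm x"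
  by (rule seminorm_le_sum_axis)
    (simp_all add: vector_scalar_commute norm_vector_scalar_mult matrix_vector_right_distrib
      norm_triangle_ineq)

section \<open>Unimodular diagonal matrices and componentwise absolute values\<close>

lemma unimodular_diag_mult_nth:
  fixes D :: "'a::real_normed_field ^ 'n ^ 'n"
  assumes "D \<in> unimodular_diag"
  shows "(D *v x) $ i = D $ i $ i * x $ i"
proof -
  have "(\<Sum>j\<in>UNIV. D $ i $ j * x $ j) = (\<Sum>j\<in>UNIV. if j = i then D $ i $ i * x $ i else 0)"
    using assms by (intro sum.cong) (auto simp: unimodular_diag_def)
  then show ?thesis
    by (simp add: matrix_vector_mult_def)
qed

lemma unimodular_diag_mat_1: "mat 1 \<in> unimodular_diag"
  by (simp add: unimodular_diag_def mat_def)

lemma unimodular_diag_mult: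
  fixes D E :: "'a::real_normed_field ^ 'n ^ 'n"
  assumes "D \<in> unimodular_diag" "E \<in> unimodular_diag"
  shows "D ** E \<in> unimodular_diag"
proof -
  have "(D ** E) $ i $ j = D $ i $ i * E $ i $ j" for i j
  proof -
    have "(\<Sum>k\<in>UNIV. D $ i $ k * E $ k $ j)
        = (\<Sum>k\<in>UNIV. if k = i then D $ i $ i * E $ i $ j else 0)"
      using assms(1) by (intro sum.cong) (auto simp: unimodular_diag_def)
    then show ?thesis
      by (simp add: matrix_matrix_mult_def)
  qed
  then show ?thesis
    using assms by (auto simp: unimodular_diag_def norm_mult)
qed

lemma unimodular_diag_chi:
  assumes "\<And>i. norm (d i) = 1"
  shows "(\<chi> i j. if i = j then d i else 0) \<in> unimodular_diag"
  using assms by (simp add: unimodular_diag_def)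

lemma vec_abs_unimodular_diag:
  assumes "D \<in> unimodular_diag"
  shows "vec_abs (D *v x) = vec_abs x"
  using assms
  by (simp add: vec_abs_def vec_eq_iff unimodular_diag_mult_nth norm_mult)
    (simp add: unimodular_diag_def)

lemma norm_vec_abs: "norm (vec_abs x) = norm x"
  by (simp add: vec_abs_def norm_vec_def)

lemma norm_unimodular_diag:
  "D \<in> unimodular_diag \<Longrightarrow> norm (D *v x) = norm x"
  by (metis norm_vec_abs vec_abs_unimodular_diag)

text \<open>Polar form in each component. It turns invariance under \<open>unimodular_diag\<close>
  into absoluteness of a norm.\<close>

lemma vec_abs_eq_unimodular_diag:
  fixes x :: "'a::real_normed_field ^ 'n"
  obtains D where "D \<in> unimodular_diag" "vec_abs x = D *v x"
proof
  \<comment> \<open>At a zero component the quotient would be 0, which is not unimodular, so 1 is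
    used there.\<close>
  let ?d = "\<lambda>i. if x $ i = 0 then 1 else of_real (norm (x $ i)) / x $ i"
  show *: "(\<chi> i j. if i = j then ?d i else 0) \<in> (unimodular_diag :: ('a ^ 'n ^ 'n) set)"
    by (rule unimodular_diag_chi) (simp add: norm_divide)
  show "vec_abs x = (\<chi> i j. if i = j then ?d i else 0) *v x"
    by (simp add: vec_eq_iff unimodular_diag_mult_nth[OF *] vec_abs_def)
qed

section \<open>Absolute norms, their equivalence with the Euclidean norm, and induced norms\<close>

text \<open>\<open>D *v x\<close> and \<open>x\<close> have the same \<open>vec_abs\<close>. This is
  how the diagonal factors drop out of norm estimates for products.\<close>

lemma absolute_norm_unimodular_diag:
  fixes N :: "'a::real_normed_field ^ 'n \<Rightarrow> real"
  assumes "N \<in> absolute_norms" "D \<in> unimodular_diag"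
  shows "N (D *v x) = N x"
proof -
  have abs: "N y = N (vec_abs y)" for y
    using assms(1) by (simp add: absolute_norms_def)
  show ?thesis
    by (metis abs vec_abs_unimodular_diag[OF assms(2)])
qed

text \<open>
  The \<open>i\<close>-th component of \<open>x\<close> is isolated by averaging \<open>x\<close> and \<open>D x\<close>, where \<open>D\<close> flips the
  sign of all other components.
\<close>

lemma absolute_norm_component_le:
  fixes N :: "'a::real_normed_field ^ 'n \<Rightarrow> real"
  assumes N: "N \<in> absolute_norms"
  shows "norm (x $ i) * N (axis i 1) \<le> N x"
proof -
  have scale: "N (c *s y) = norm c * N y" and triangle: "N (y + z) \<le> N y + N z" for c y z
    using N by (auto simp: absolute_norms_def is_norm_def)
  define D :: "'a ^ 'n ^ 'n" where
    "D = (\<chi> k j. if k = j then (if k = i then 1 else - 1) else 0)"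
  have D: "D \<in> unimodular_diag"
    unfolding D_def by (rule unimodular_diag_chi) simp
  have "x + D *v x = (2 * x $ i) *s axis i 1"
    by (simp add: vec_eq_iff unimodular_diag_mult_nth[OF D]) (simp add: D_def axis_def)
  then have "norm (2 * x $ i) * N (axis i 1) = N (x + D *v x)"
    by (simp add: scale)
  also have "\<dots> \<le> N x + N x"
    using triangle[of x "D *v x"] absolute_norm_unimodular_diag[OF N D] by simp
  finally show ?thesis
    by (simp add: norm_mult)
qed

text \<open>Summing the componentwise bounds \<open>norm (x $ i) \<le> N x / N (axis i 1)\<close>
  gives this half of norm equivalence with an explicit constant and without a compactness
  argument.\<close>

lemma norm_le_absolute_norm:
  fixes N :: "'a::real_normed_field ^ 'n \<Rightarrow> real"
  assumes N: "N \<in> absolute_norms"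
  obtains C where "C > 0" "\<And>x. norm x \<le> C * N x"
proof
  have pos: "N (axis i 1) > 0" for i
    using N by (simp add: absolute_norms_def is_norm_def less_le axis_eq_0_iff)
  show "(\<Sum>i\<in>UNIV. 1 / N (axis i 1)) > 0"
    using pos by (intro sum_pos) auto
  fix x :: "'a ^ 'n"
  have "norm x \<le> (\<Sum>i\<in>UNIV. norm (x $ i))"
    unfolding norm_vec_def by (rule L2_set_le_sum) simp
  also have "\<dots> \<le> (\<Sum>i\<in>UNIV. N x / N (axis i 1))"
    using pos absolute_norm_component_le[OF N] by (intro sum_mono) (simp add: field_simps)
  finally show "norm x \<le> (\<Sum>i\<in>UNIV. 1 / N (axis i 1)) * N x"
    by (simp add: sum_distrib_right)
qed

lemma absolute_norm_le_norm:
  fixes N :: "'a::real_normed_field ^ 'n \<Rightarrow> real"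
  assumes N: "N \<in> absolute_norms"
  obtains C where "C > 0" "\<And>x. N x \<le> C * norm x"
proof
  have "N (axis i 1) > 0" for i
    using N by (simp add: absolute_norms_def is_norm_def less_le axis_eq_0_iff)
  then show "(\<Sum>i\<in>UNIV. N (axis i 1)) > 0"
    by (intro sum_pos) auto
  show "N x \<le> (\<Sum>i\<in>UNIV. N (axis i 1)) * norm x" for x
    using N by (intro seminorm_le_sum_axis) (auto simp: absolute_norms_def is_norm_def)
qed

lemma
  fixes N :: "'a::real_normed_field ^ 'n \<Rightarrow> real"
  assumes N: "N \<in> absolute_norms"
  shows induced_norm_nonneg: "0 \<le> induced_norm N A"
    and absolute_norm_matrix_vector_le: "N (A *v x) \<le> induced_norm N A * N x"
proof -
  have nonneg: "0 \<le> N y" and zero: "N y = 0 \<longleftrightarrow> y = 0"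
    and scale: "N (c *s y) = norm c * N y" for c y
    using N by (auto simp: absolute_norms_def is_norm_def)
  obtain C where C: "C > 0" "\<And>x. norm x \<le> C * N x"
    using norm_le_absolute_norm[OF N] by blast
  obtain C' where C': "C' > 0" "\<And>x. N x \<le> C' * norm x"
    using absolute_norm_le_norm[OF N] by blast
  define K where "K = (\<Sum>i\<in>UNIV. norm (A *v axis i 1))"
  have "K \<ge> 0"
    by (simp add: K_def sum_nonneg)
  \<comment> \<open>Equivalence with the Euclidean norm makes the supremum in
    \<open>induced_norm\<close> a genuine least upper bound.\<close>
  have bdd: "bdd_above {N (A *v x) | x. N x \<le> 1}"
  proof (rule bdd_aboveI, clarsimp)
    fix y assume y: "N y \<le> 1"
    have "N (A *v y) \<le> C' * norm (A *v y)"
      by (rule C')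
    also have "\<dots> \<le> C' * (K * norm y)"
      using norm_matrix_vector_le[of A y] C' by (simp add: K_def)
    also have "\<dots> \<le> C' * (K * C)"
    proof -
      have "norm y \<le> C"
        using order_trans[OF C(2) mult_left_mono[OF y, of C]] C(1) by simp
      then show ?thesis
        using C'(1) \<open>K \<ge> 0\<close> by (simp add: mult_left_mono)
    qed
    finally show "N (A *v y) \<le> C' * (K * C)" .
  qed
  have upper: "N (A *v y) \<le> induced_norm N A" if "N y \<le> 1" for y
    unfolding induced_norm_def using that by (intro cSup_upper bdd) auto
  show "0 \<le> induced_norm N A"
    using upper[of 0] nonneg[of "A *v 0"] zero[of 0] by simp
  show "N (A *v x) \<le> induced_norm N A * N x"
  proof (cases "x = 0")
    case True
    then show ?thesis
      using zero[of 0] by simp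
  next
    case False
    then have pos: "N x > 0"
      using nonneg[of x] zero[of x] by simp
    have "N (A *v (of_real (1 / N x) *s x)) \<le> induced_norm N A"
      using pos by (intro upper) (simp add: scale norm_divide)
    then show ?thesis
      using pos by (simp add: vector_scalar_commute scale norm_divide field_simps)
  qed
qed

section \<open>Growth of products with interleaved diagonal factors\<close>

definition max_growth :: "'a::real_normed_field ^ 'n ^ 'n \<Rightarrow> nat \<Rightarrow> real" where
  "max_growth A k = Sup {norm (interleaved_prod A Ds *v x) | Ds x.
     length Ds = k \<and> set Ds \<subseteq> unimodular_diag \<and> norm x = 1}"

lemma mu_eq_max_growth: "mu A = limsup (\<lambda>k. ereal (root k (max_growth A k)))"
  by (simp add: mu_def max_growth_def)

lemma interleaved_prod_append:
  "interleaved_prod A (Ds @ Es) = interleaved_prod A Ds ** interleaved_prod A Es"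
  by (induction Ds) (simp_all add: matrix_mul_assoc)

text \<open>Each factor \<open>A\<close> costs a factor \<open>a\<close>, each diagonal factor
  nothing. The constant is left free so that it can be the induced norm or, for the Euclidean norm,
  the crude sum of column norms.\<close>

lemma absolute_norm_interleaved_prod_le:
  assumes N: "N \<in> absolute_norms" and "set Ds \<subseteq> unimodular_diag"
    and "0 \<le> a" and a: "\<And>x. N (A *v x) \<le> a * N x"
  shows "N (interleaved_prod A Ds *v x) \<le> a ^ length Ds * N x"
  using assms(2)
proof (induction Ds)
  case (Cons D Ds)
  have "N (interleaved_prod A (D # Ds) *v x) = N (A *v (D *v (interleaved_prod A Ds *v x)))"
    by (simp add: matrix_vector_mul_assoc matrix_mul_assoc)
  also have "\<dots> \<le> a * N (D *v (interleaved_prod A Ds *v x))"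
    by (rule a)
  also have "\<dots> = a * N (interleaved_prod A Ds *v x)"
    using absolute_norm_unimodular_diag[OF N] Cons.prems by simp
  also have "\<dots> \<le> a * (a ^ length Ds * N x)"
    using Cons \<open>0 \<le> a\<close> by (intro mult_left_mono) auto
  finally show ?case
    by simp
qed simp

lemma norm_absolute_norms: "norm \<in> absolute_norms"
  by (simp add: absolute_norms_def is_norm_def norm_vector_scalar_mult norm_vec_abs
      norm_triangle_ineq)

lemma max_growth_set_nonempty:
  fixes A :: "'a::real_normed_field ^ 'n ^ 'n"
  shows "{norm (interleaved_prod A Ds *v x) | Ds x.
     length Ds = k \<and> set Ds \<subseteq> unimodular_diag \<and> norm x = 1} \<noteq> {}"
proof -
  let ?Ds = "replicate k (mat 1 :: 'a ^ 'n ^ 'n)"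
  have "length ?Ds = k" "set ?Ds \<subseteq> unimodular_diag"
    by (auto simp: unimodular_diag_mat_1)
  moreover have "norm (axis undefined 1 :: 'a ^ 'n) = 1"
    by (rule norm_axis_one)
  ultimately show ?thesis
    by blast
qed

text \<open>Homogeneity carries the bound from unit vectors to all vectors. The supremum is finite
  because products of a fixed length are bounded by a power of the sum of column norms.\<close>

lemma norm_interleaved_prod_le_max_growth:
  fixes A :: "'a::real_normed_field ^ 'n ^ 'n"
  assumes Ds: "set Ds \<subseteq> unimodular_diag"
  shows "norm (interleaved_prod A Ds *v x) \<le> max_growth A (length Ds) * norm x"
proof (cases "x = 0")
  case False
  have "bdd_above {norm (interleaved_prod A Es *v x) | Es x.
     length Es = length Ds \<and> set Es \<subseteq> unimodular_diag \<and> norm x = 1}"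
  proof (rule bdd_aboveI, clarify)
    fix Es :: "('a ^ 'n ^ 'n) list" and y :: "'a ^ 'n"
    assume "length Es = length Ds" "set Es \<subseteq> unimodular_diag" "norm y = 1"
    then show "norm (interleaved_prod A Es *v y)
        \<le> (\<Sum>i\<in>UNIV. norm (A *v axis i 1)) ^ length Ds"
      using absolute_norm_interleaved_prod_le
        [OF norm_absolute_norms _ sum_nonneg norm_matrix_vector_le, of Es A y]
      by simp
  qed
  moreover have "norm (of_real (1 / norm x) *s x) = 1"
    using False by (simp add: norm_vector_scalar_mult norm_divide)
  ultimately have "norm (interleaved_prod A Ds *v (of_real (1 / norm x) *s x))
      \<le> max_growth A (length Ds)"
    unfolding max_growth_def using Ds by (intro cSup_upper) blast+
  then show ?thesis
    using False
    by (simp add: vector_scalar_commute norm_vector_scalar_mult norm_divide field_simps)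
qed simp

lemma max_growth_nonneg: "0 \<le> max_growth A k"
proof -
  have "set (replicate k (mat 1)) \<subseteq> unimodular_diag"
    by (auto simp: unimodular_diag_mat_1)
  from order_trans[OF norm_ge_zero norm_interleaved_prod_le_max_growth[OF this, of A "axis undefined 1"]]
  show ?thesis
    by (simp add: norm_axis_one)
qed

text \<open>Makes every real \<open>r\<close> above \<open>mu A\<close> positive, so that powers of
  \<open>r\<close> can serve as denominators in \<open>orbit_norm\<close>.\<close>

lemma mu_nonneg: "0 \<le> mu A"
  unfolding mu_eq_max_growth
  by (intro le_Limsup always_eventually) (simp_all add: max_growth_nonneg real_root_ge_zero)

section \<open>Every induced norm bounds \<open>mu\<close> from above\<close>

lemma mu_le_induced_norm:
  fixes A :: "'a::real_normed_field ^ 'n ^ 'n"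
  assumes N: "N \<in> absolute_norms"
  shows "mu A \<le> ereal (induced_norm N A)"
proof -
  define a where "a = induced_norm N A"
  have a: "0 \<le> a"
    by (simp add: a_def induced_norm_nonneg[OF N])
  obtain C where C: "C > 0" "\<And>x. norm x \<le> C * N x"
    using norm_le_absolute_norm[OF N] by blast
  obtain C' where C': "C' > 0" "\<And>x. N x \<le> C' * norm x"
    using absolute_norm_le_norm[OF N] by blast
  \<comment> \<open>\<open>C'\<close> is paid once to pass from the Euclidean norm of the unit
    vector to \<open>N\<close>, and \<open>C\<close> once to return, so the constant does not depend
    on \<open>k\<close>.\<close>
  have growth: "max_growth A k \<le> C * C' * a ^ k" for k
    unfolding max_growth_def
  proof (rule cSup_least[OF max_growth_set_nonempty], clarify)
    fix Ds :: "('a ^ 'n ^ 'n) list" and x :: "'a ^ 'n"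
    assume *: "k = length Ds" "set Ds \<subseteq> unimodular_diag" "norm x = 1"
    have "norm (interleaved_prod A Ds *v x) \<le> C * N (interleaved_prod A Ds *v x)"
      by (rule C)
    also have "\<dots> \<le> C * (a ^ length Ds * N x)"
      using absolute_norm_interleaved_prod_le[OF N *(2) a] C(1)
        absolute_norm_matrix_vector_le[OF N] by (simp add: a_def)
    also have "\<dots> \<le> C * (a ^ length Ds * C')"
      using C(1) C'(2)[of x] * a by (intro mult_left_mono) auto
    finally show "norm (interleaved_prod A Ds *v x) \<le> C * C' * a ^ length Ds"
      by (simp add: mult_ac)
  qed
  \<comment> \<open>\<open>k = 0\<close> is set aside because \<open>root k\<close> inverts the
    \<open>k\<close>-th power only for positive \<open>k\<close>.\<close>
  have "eventually (\<lambda>k. ereal (root k (max_growth A k)) \<le> ereal (root k (C * C') * a)) sequentially"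
    using eventually_gt_at_top[of 0]
  proof eventually_elim
    case (elim k)
    have "root k (max_growth A k) \<le> root k (C * C' * a ^ k)"
      using elim growth by simp
    then show ?case
      using elim a by (simp add: real_root_mult real_root_power_cancel)
  qed
  then have "mu A \<le> limsup (\<lambda>k. ereal (root k (C * C') * a))"
    unfolding mu_eq_max_growth by (rule Limsup_mono)
  \<comment> \<open>The \<open>k\<close>-th roots of the fixed positive number \<open>C * C'\<close>
    tend to 1.\<close>
  also have "(\<lambda>k. ereal (root k (C * C') * a)) \<longlonglongrightarrow> ereal a"
    using tendsto_mult_right[OF LIMSEQ_root_const[of "C * C'"], of a] C(1) C'(1) by simp
  then have "limsup (\<lambda>k. ereal (root k (C * C') * a)) = ereal a"
    by (intro lim_imp_Limsup) simp_all
  finally show ?thesis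
    by (simp add: a_def)
qed

section \<open>An absolute norm built from all products\<close>

text \<open>A norm of Rota-Strang type for the set of all \<open>A ** D\<close>, scaled by
  \<open>1 / r\<close>. The empty list contributes the Euclidean norm of \<open>x\<close>; the
  trailing \<open>D\<close> makes the value invariant under \<open>unimodular_diag\<close>.\<close>

definition orbit_norm :: "real \<Rightarrow> 'a::real_normed_field ^ 'n ^ 'n \<Rightarrow> 'a ^ 'n \<Rightarrow> real" where
  "orbit_norm r A x = Sup {norm (interleaved_prod A Ds *v (D *v x)) / r ^ length Ds | Ds D.
     set Ds \<subseteq> unimodular_diag \<and> D \<in> unimodular_diag}"

context
  fixes A :: "'a::real_normed_field ^ 'n ^ 'n" and r B :: real
  assumes r: "0 < r" and B: "\<And>k. max_growth A k \<le> B * r ^ k"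
begin

text \<open>The growth assumption bounds every quotient by \<open>B * norm x\<close>, so the
  supremum is finite.\<close>

lemma orbit_norm_upper:
  assumes "set Ds \<subseteq> unimodular_diag" "D \<in> unimodular_diag"
  shows "norm (interleaved_prod A Ds *v (D *v x)) \<le> r ^ length Ds * orbit_norm r A x"
proof -
  have "bdd_above {norm (interleaved_prod A Ds *v (D *v x)) / r ^ length Ds | Ds D.
     set Ds \<subseteq> unimodular_diag \<and> D \<in> unimodular_diag}"
  proof (rule bdd_aboveI, clarify)
    fix Ds :: "('a ^ 'n ^ 'n) list" and D :: "'a ^ 'n ^ 'n"
    assume *: "set Ds \<subseteq> unimodular_diag" "D \<in> unimodular_diag"
    have "norm (interleaved_prod A Ds *v (D *v x)) \<le> max_growth A (length Ds) * norm x"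
      using norm_interleaved_prod_le_max_growth[OF *(1), of A "D *v x"] *(2)
      by (simp add: norm_unimodular_diag)
    also have "\<dots> \<le> B * r ^ length Ds * norm x"
      by (intro mult_right_mono B) simp
    finally show "norm (interleaved_prod A Ds *v (D *v x)) / r ^ length Ds \<le> B * norm x"
      using r by (simp add: field_simps)
  qed
  then have "norm (interleaved_prod A Ds *v (D *v x)) / r ^ length Ds \<le> orbit_norm r A x"
    unfolding orbit_norm_def using assms by (intro cSup_upper) blast+
  then show ?thesis
    using r by (simp add: field_simps)
qed

text \<open>Together with \<open>orbit_norm_upper\<close> this characterizes the supremum in a form
  free of division; the norm properties below follow from the two without unfolding
  \<open>orbit_norm\<close>.\<close>

lemma orbit_norm_least:
  assumes "\<And>Ds D. set Ds \<subseteq> unimodular_diag \<Longrightarrow> D \<in> unimodular_diag \<Longrightarrow>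
    norm (interleaved_prod A Ds *v (D *v x)) \<le> r ^ length Ds * c"
  shows "orbit_norm r A x \<le> c"
  unfolding orbit_norm_def
proof (rule cSup_least)
  have "set [] \<subseteq> unimodular_diag" "mat 1 \<in> unimodular_diag"
    by (simp_all add: unimodular_diag_mat_1)
  then show "{norm (interleaved_prod A Ds *v (D *v x)) / r ^ length Ds | Ds D.
     set Ds \<subseteq> unimodular_diag \<and> D \<in> unimodular_diag} \<noteq> {}"
    by blast
next
  fix y
  assume "y \<in> {norm (interleaved_prod A Ds *v (D *v x)) / r ^ length Ds | Ds D.
     set Ds \<subseteq> unimodular_diag \<and> D \<in> unimodular_diag}"
  then obtain Ds D where "y = norm (interleaved_prod A Ds *v (D *v x)) / r ^ length Ds"
    "set Ds \<subseteq> unimodular_diag" "D \<in> unimodular_diag"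
    by blast
  then show "y \<le> c"
    using assms r by (simp add: pos_divide_le_eq mult.commute)
qed

text \<open>The empty product is one of the competitors. Nonnegativity and definiteness of
  \<open>orbit_norm\<close> come from here.\<close>

lemma norm_le_orbit_norm: "norm x \<le> orbit_norm r A x"
  using orbit_norm_upper[of "[]" "mat 1" x] by (simp add: unimodular_diag_mat_1)

text \<open>\<open>E\<close> merges with the trailing factor \<open>D\<close> into
  \<open>D ** E\<close>. A one-sided bound suffices, since the inverse of a unimodular diagonal
  matrix is again one.\<close>

lemma orbit_norm_unimodular_diag_le:
  assumes "E \<in> unimodular_diag"
  shows "orbit_norm r A (E *v x) \<le> orbit_norm r A x"
  using orbit_norm_upper[of _ "_ ** E" x] assms
  by (intro orbit_norm_least) (simp add: unimodular_diag_mult matrix_vector_mul_assoc matrix_mul_assoc)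

lemma orbit_norm_scale_le: "orbit_norm r A (c *s x) \<le> norm c * orbit_norm r A x"
proof (rule orbit_norm_least)
  fix Ds :: "('a ^ 'n ^ 'n) list" and D :: "'a ^ 'n ^ 'n"
  assume "set Ds \<subseteq> unimodular_diag" "D \<in> unimodular_diag"
  from mult_left_mono[OF orbit_norm_upper[OF this, of x] norm_ge_zero[of c]]
  show "norm (interleaved_prod A Ds *v (D *v (c *s x)))
      \<le> r ^ length Ds * (norm c * orbit_norm r A x)"
    by (simp add: vector_scalar_commute norm_vector_scalar_mult mult_ac)
qed

lemma orbit_norm_triangle: "orbit_norm r A (x + y) \<le> orbit_norm r A x + orbit_norm r A y"
proof (rule orbit_norm_least)
  fix Ds :: "('a ^ 'n ^ 'n) list" and D :: "'a ^ 'n ^ 'n"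
  assume *: "set Ds \<subseteq> unimodular_diag" "D \<in> unimodular_diag"
  show "norm (interleaved_prod A Ds *v (D *v (x + y)))
      \<le> r ^ length Ds * (orbit_norm r A x + orbit_norm r A y)"
    unfolding matrix_vector_right_distrib distrib_left
    by (rule norm_triangle_mono[OF orbit_norm_upper[OF *] orbit_norm_upper[OF *]])
qed

lemma orbit_norm_absolute: "orbit_norm r A \<in> absolute_norms"
proof -
  have nonneg: "0 \<le> orbit_norm r A x" for x
    using norm_le_orbit_norm[of x] norm_ge_zero[of x] by linarith
  have zero: "orbit_norm r A 0 = 0"
    using orbit_norm_scale_le[of 0 0] nonneg[of 0] by simp
  have scale: "orbit_norm r A (c *s x) = norm c * orbit_norm r A x" for c x
  proof (cases "c = 0")
    case False
    \<comment> \<open>The other half of homogeneity is the one-sided bound for the scalar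
      \<open>inverse c\<close> and the vector \<open>c *s x\<close>.\<close>
    have "orbit_norm r A x \<le> inverse (norm c) * orbit_norm r A (c *s x)"
      using orbit_norm_scale_le[of "inverse c" "c *s x"] False
      by (simp add: norm_inverse del: inverse_eq_divide)
    then have "norm c * orbit_norm r A x \<le> orbit_norm r A (c *s x)"
      using False by (simp add: field_simps)
    with orbit_norm_scale_le[of c x] show ?thesis
      by simp
  qed (simp add: zero)
  have "orbit_norm r A x = orbit_norm r A (vec_abs x)" for x
  proof (rule antisym)
    obtain D where D: "D \<in> unimodular_diag" "vec_abs x = D *v x"
      by (rule vec_abs_eq_unimodular_diag)
    then show "orbit_norm r A (vec_abs x) \<le> orbit_norm r A x"
      by (simp add: orbit_norm_unimodular_diag_le)
    \<comment> \<open>\<open>E\<close> is the inverse of \<open>D\<close>, so it leads back from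
      \<open>vec_abs x\<close> to \<open>x\<close>.\<close>
    define E :: "'a ^ 'n ^ 'n" where "E = (\<chi> i j. if i = j then inverse (D $ i $ i) else 0)"
    have E: "E \<in> unimodular_diag"
      unfolding E_def using D(1)
      by (intro unimodular_diag_chi) (simp add: unimodular_diag_def norm_inverse)
    have "D $ i $ i \<noteq> 0" for i
      using D(1) by (auto simp: unimodular_diag_def dest!: spec[of _ i])
    then have "x = E *v vec_abs x"
      by (simp add: D(2) vec_eq_iff unimodular_diag_mult_nth[OF E] unimodular_diag_mult_nth[OF D(1)])
        (simp add: E_def)
    then show "orbit_norm r A x \<le> orbit_norm r A (vec_abs x)"
      using orbit_norm_unimodular_diag_le[OF E, of "vec_abs x"] by simp
  qed
  moreover have "orbit_norm r A x = 0 \<longleftrightarrow> x = 0" for x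
    using norm_le_orbit_norm[of x] zero by auto
  ultimately show ?thesis
    by (simp add: absolute_norms_def is_norm_def nonneg scale orbit_norm_triangle)
qed

text \<open>
  The diagonal matrix standing before \<open>A x\<close> is absorbed by the preceding factor of the product
  or, if there is none, by the Euclidean norm.
\<close>

lemma orbit_norm_matrix_vector_le: "orbit_norm r A (A *v x) \<le> r * orbit_norm r A x"
proof (rule orbit_norm_least)
  fix Ds :: "('a ^ 'n ^ 'n) list" and D :: "'a ^ 'n ^ 'n"
  assume *: "set Ds \<subseteq> unimodular_diag" "D \<in> unimodular_diag"
  show "norm (interleaved_prod A Ds *v (D *v (A *v x)))
      \<le> r ^ length Ds * (r * orbit_norm r A x)"
  proof (cases Ds rule: rev_cases)
    case Nil
    then show ?thesis
      using orbit_norm_upper[of "[mat 1]" "mat 1" x] *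
      by (simp add: unimodular_diag_mat_1 norm_unimodular_diag)
  next
    case (snoc Es E)
    then have "interleaved_prod A Ds *v (D *v (A *v x))
        = interleaved_prod A (Es @ [E ** D, mat 1]) *v (mat 1 *v x)"
      by (simp add: interleaved_prod_append matrix_vector_mul_assoc matrix_mul_assoc)
    then show ?thesis
      using orbit_norm_upper[of "Es @ [E ** D, mat 1]" "mat 1" x] * snoc
      by (simp add: unimodular_diag_mat_1 unimodular_diag_mult mult_ac)
  qed
qed

lemma induced_orbit_norm_le: "induced_norm (orbit_norm r A) A \<le> r"
  unfolding induced_norm_def
proof (rule cSup_least)
  have "orbit_norm r A 0 \<le> 1"
    using orbit_norm_scale_le[of 0 0] by simp
  then show "{orbit_norm r A (A *v x) | x. orbit_norm r A x \<le> 1} \<noteq> {}"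
    by blast
next
  fix y
  assume "y \<in> {orbit_norm r A (A *v x) | x. orbit_norm r A x \<le> 1}"
  then obtain x where "y = orbit_norm r A (A *v x)" "orbit_norm r A x \<le> 1"
    by blast
  then show "y \<le> r"
    using order_trans[OF orbit_norm_matrix_vector_le mult_left_mono[of "orbit_norm r A x" 1 r]] r
    by simp
qed

end

section \<open>From the limit superior to the reverse inequality\<close>

text \<open>The limit superior controls \<open>max_growth A k\<close> only for large
  \<open>k\<close>, where \<open>r ^ k\<close> is already a bound. The finitely many remaining
  values are absorbed by \<open>B\<close>.\<close>

lemma max_growth_le_power:
  assumes "mu A < ereal r" "0 < r"
  obtains B where "\<And>k. max_growth A k \<le> B * r ^ k"
proof -
  have "eventually (\<lambda>k. ereal (root k (max_growth A k)) < ereal r) sequentially"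
    using assms(1) unfolding mu_eq_max_growth by (rule Limsup_lessD)
  then have "eventually (\<lambda>k. norm (max_growth A k / r ^ k) \<le> 1) sequentially"
    using eventually_gt_at_top[of 0]
  proof eventually_elim
    case (elim k)
    have "max_growth A k = root k (max_growth A k) ^ k"
      using elim by (simp add: max_growth_nonneg)
    also have "\<dots> \<le> r ^ k"
      using elim by (intro power_mono) (simp_all add: max_growth_nonneg)
    finally show ?case
      using assms(2) by (simp add: max_growth_nonneg)
  qed
  then have "Bseq (\<lambda>k. max_growth A k / r ^ k)"
    by (rule BfunI)
  then obtain B where B: "\<And>k. norm (max_growth A k / r ^ k) \<le> B"
    by (auto simp: Bseq_def)
  have "max_growth A k \<le> B * r ^ k" for k
    using B[of k] assms(2) by (simp add: max_growth_nonneg field_simps)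
  then show ?thesis
    by (rule that)
qed

text \<open>The argument uses only a multiplicative norm on the scalars and the embedding of the
  reals, so the real and the complex case are instances of one statement.\<close>

lemma mu_eq_INF_induced_norm:
  fixes A :: "'a::real_normed_field ^ 'n ^ 'n"
  shows "mu A = (INF N\<in>absolute_norms. ereal (induced_norm N A))"
proof (rule antisym)
  show "mu A \<le> (INF N\<in>absolute_norms. ereal (induced_norm N A))"
    by (intro INF_greatest mu_le_induced_norm)
  show "(INF N\<in>absolute_norms. ereal (induced_norm N A)) \<le> mu A"
  \<comment> \<open>The infimum need not be attained: for a nonzero strictly upper triangular
    \<open>A\<close> both sides are 0, while every induced norm is positive. Hence the comparison
    with all \<open>s\<close> above \<open>mu A\<close>, of which only the finite ones carry
    content.\<close>
  proof (rule dense_ge)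
    fix s assume s: "mu A < s"
    show "(INF N\<in>absolute_norms. ereal (induced_norm N A)) \<le> s"
    proof (cases s)
      case (real r)
      then have "0 < r"
        using s mu_nonneg[of A] by (metis ereal_less(2) order_le_less_trans)
      then obtain B where "\<And>k. max_growth A k \<le> B * r ^ k"
        using max_growth_le_power s real by blast
      note * = orbit_norm_absolute[OF \<open>0 < r\<close> this] induced_orbit_norm_le[OF \<open>0 < r\<close> this]
      show ?thesis
        unfolding real by (rule INF_lower2[OF *(1)]) (simp add: *(2))
    next
      case MInf
      then show ?thesis
        using s by simp
    qed simp
  qed
qed

theorem theorem3p3:
  shows "(\<forall>A :: real ^ 'n ^ 'n. mu A = (INF N\<in>absolute_norms. ereal (induced_norm N A))) \<and>
         (\<forall>A :: complex ^ 'n ^ 'n. mu A = (INF N\<in>absolute_norms. ereal (induced_norm N A)))"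
  by (simp add: mu_eq_INF_induced_norm)

end
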